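(* Let $n\ge 1$. Every clique in the partition graph $G_n$ is contained in a star-simplex or in a top-simplex.
   Context: A partition of $n$ is a weakly decreasing sequence $\lambda=(\lambda_1\ge\cdots\ge\lambda_\ell>0)$ of positive integers with sum $n$, identified with its Ferrers diagram ($\lambda_i$ left-justified cells in row $i$); set $\lambda_{\ell+1}=0$. The partition graph $G_n$ has as vertices all partitions of $n$; two distinct partitions are adjacent if one is obtained from the other by removing one cell from a row, adding it to another row (possibly a new row of length $0$), and reordering the row lengths into weakly decreasing order. A clique is a finite nonempty set of pairwise adjacent vertices. A removable corner of $\lambda$ is the last cell of a row whose length is strictly greater than that of the next row; an addable corner is a position where a cell can be added so that the result is again a Ferrers diagram of a partition (row $\ell+1$ allowed). Write $r(\cdot)$ for the row number of a corner. For a removable corner $c$ and an addable corner $a$ of $\lambda$ with $r(c)\ne r(a)$, remove $c$ (decrease row length $\lambda_{r(c)}$ by $1$), add a cell at $a$ (increase $\lambda_{r(a)}$ by $1$), and reorder row lengths. If the result is a partition of $n$ different from $\lambda$, the transfer is called admissible and the result is denoted $\lambda(c\to a)$. The neighbors of $\lambda$ in $G_n$ are exactly the partitions $\lambda(c\to a)$ for admissible transfers. A star-simplex based at $(\lambda,c)$, with $c$ a removable corner of $\lambda$, is a set $\{\lambda\}\cup\{\lambda(c\to a):a\in A\}$, where $A$ is a finite (possibly empty) set of addable corners such that every transfer $\lambda(c\to a)$, $a\in A$, is admissible. A top-simplex based at $(\lambda,a)$, with $a$ an addable corner of $\lambda$, is a set $\{\lambda\}\cup\{\lambda(c\to a):c\in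 C\}$, where $C$ is a finite (possibly empty) set of removable corners such that every transfer $\lambda(c\to a)$, $c\in C$, is admissible. Here $\lambda$ ranges over partitions of $n$. *)

theory Defs
  imports Main
begin

text \<open>
  Partitions are weakly decreasing lists of positive naturals.  Rows and columns of a Ferrers
  diagram are numbered from 0, so for a partition with \<open>l\<close> parts the rows are \<open>0, \<dots>, l - 1\<close> and
  row \<open>l\<close> is the new (empty) row.
\<close>

definition partition_of :: "nat \<Rightarrow> nat list \<Rightarrow> bool" where
  "partition_of n lam \<longleftrightarrow>
     sorted_wrt (\<ge>) lam \<and> (\<forall>k \<in> set lam. 0 < k) \<and> sum_list lam = n"

definition row_len :: "nat list \<Rightarrow> nat \<Rightarrow> nat" where
  "row_len lam i = (if i < length lam then lam ! i else 0)"

definition ferrers :: "nat list \<Rightarrow> (nat \<times> nat) set" where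
  "ferrers lam = {(i, j). i < length lam \<and> j < lam ! i}"

text \<open>
  Remove a cell from row \<open>i\<close>, add a cell to row \<open>j\<close> (possibly the new row), and reorder; a row
  that has become empty is dropped.  Only meaningful for \<open>i < length lam\<close>, \<open>j \<le> length lam\<close>
  and \<open>i \<noteq> j\<close>, which is guaranteed wherever it is used.
\<close>

definition move_cell :: "nat list \<Rightarrow> nat \<Rightarrow> nat \<Rightarrow> nat list" where
  "move_cell lam i j =
     rev (sort (filter (\<lambda>k. 0 < k)
       ((lam @ [0]) [i := row_len lam i - 1, j := row_len lam j + 1])))"

definition obtained_by_move :: "nat list \<Rightarrow> nat list \<Rightarrow> bool" where
  "obtained_by_move lam mu \<longleftrightarrow>
     (\<exists>i j. i < length lam \<and> j \<le> length lam \<and> i \<noteq> j \<and> mu = move_cell lam i j)"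

definition adjacent :: "nat \<Rightarrow> nat list \<Rightarrow> nat list \<Rightarrow> bool" where
  "adjacent n lam mu \<longleftrightarrow>
     partition_of n lam \<and> partition_of n mu \<and> lam \<noteq> mu \<and>
     (obtained_by_move lam mu \<or> obtained_by_move mu lam)"

definition is_clique :: "nat \<Rightarrow> nat list set \<Rightarrow> bool" where
  "is_clique n K \<longleftrightarrow>
     finite K \<and> K \<noteq> {} \<and> (\<forall>lam \<in> K. partition_of n lam) \<and> pairwise (adjacent n) K"

text \<open>Corners are cells \<open>(row, column)\<close>; the row number of a corner is its first component.\<close>

definition removable_corners :: "nat list \<Rightarrow> (nat \<times> nat) set" where
  "removable_corners lam =
     {(i, row_len lam i - 1) | i. i < length lam \<and> row_len lam (Suc i) < row_len lam i}"

definition addable_corners :: "nat list \<Rightarrow> (nat \<times> nat) set" where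
  "addable_corners lam =
     {a. a \<notin> ferrers lam \<and>
         (\<exists>m mu. partition_of m mu \<and> ferrers mu = insert a (ferrers lam))}"

definition transfer_cell :: "nat list \<Rightarrow> nat \<times> nat \<Rightarrow> nat \<times> nat \<Rightarrow> nat list" where
  "transfer_cell lam c a = move_cell lam (fst c) (fst a)"

definition admissible :: "nat \<Rightarrow> nat list \<Rightarrow> nat \<times> nat \<Rightarrow> nat \<times> nat \<Rightarrow> bool" where
  "admissible n lam c a \<longleftrightarrow>
     c \<in> removable_corners lam \<and> a \<in> addable_corners lam \<and> fst c \<noteq> fst a \<and>
     partition_of n (transfer_cell lam c a) \<and> transfer_cell lam c a \<noteq> lam"

definition star_simplex_at :: "nat \<Rightarrow> nat list \<Rightarrow> nat \<times> nat \<Rightarrow> nat list set \<Rightarrow> bool" where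
  "star_simplex_at n lam c S \<longleftrightarrow>
     partition_of n lam \<and> c \<in> removable_corners lam \<and>
     (\<exists>A. finite A \<and> A \<subseteq> addable_corners lam \<and> (\<forall>a \<in> A. admissible n lam c a) \<and>
          S = insert lam ((\<lambda>a. transfer_cell lam c a) ` A))"

definition top_simplex_at :: "nat \<Rightarrow> nat list \<Rightarrow> nat \<times> nat \<Rightarrow> nat list set \<Rightarrow> bool" where
  "top_simplex_at n lam a S \<longleftrightarrow>
     partition_of n lam \<and> a \<in> addable_corners lam \<and>
     (\<exists>C. finite C \<and> C \<subseteq> removable_corners lam \<and> (\<forall>c \<in> C. admissible n lam c a) \<and>
          S = insert lam ((\<lambda>c. transfer_cell lam c a) ` C))"

definition star_simplex :: "nat \<Rightarrow> nat list set \<Rightarrow> bool" where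
  "star_simplex n S \<longleftrightarrow> (\<exists>lam c. star_simplex_at n lam c S)"

definition top_simplex :: "nat \<Rightarrow> nat list set \<Rightarrow> bool" where
  "top_simplex n S \<longleftrightarrow> (\<exists>lam a. top_simplex_at n lam a S)"

end

theory Submission
  imports Defs "HOL-Library.Multiset"
begin

text \<open>
  Pass to the conjugate partition: in terms of column lengths, moving a cell from a row of
  length \<open>p\<close> to a row of length \<open>q - 1\<close> lowers column \<open>p\<close> by one and raises column \<open>q\<close> by one.
  Hence adjacent partitions have column vectors differing by a root \<open>e\<^sub>q - e\<^sub>p\<close>. Two such
  neighbours of \<open>\<lambda>\<close>, given by \<open>(p, q)\<close> and \<open>(p', q')\<close>, are adjacent only if \<open>p = p'\<close> or
  \<open>q = q'\<close>, since otherwise \<open>(e\<^sub>q - e\<^sub>p) - (e\<^sub>q\<^sub>' - e\<^sub>p\<^sub>')\<close> is not a root. A set of pairs any two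
  of which share a coordinate lies on a line, so around any of its members a clique has constant
  \<open>p\<close> (a star-simplex) or constant \<open>q\<close> (a top-simplex).
\<close>

text \<open>Columns are numbered from 1 here, so that column \<open>k\<close> meets exactly the rows of length \<open>\<ge> k\<close>.\<close>

definition column_len :: "nat list \<Rightarrow> nat \<Rightarrow> nat" where
  "column_len lam k = length (filter (\<lambda>x. k \<le> x) lam)"

text \<open>The equation is additive so that truncated subtraction on \<open>nat\<close> never
  enters.\<close>

definition column_shift :: "nat list \<Rightarrow> nat list \<Rightarrow> nat \<Rightarrow> nat \<Rightarrow> bool" where
  "column_shift lam mu p q \<longleftrightarrow> 1 \<le> p \<and> 1 \<le> q \<and> p \<noteq> q \<and>
     (\<forall>k\<ge>1. column_len mu k + of_bool (k = p) = column_len lam k + of_bool (k = q))"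

section \<open>Recovering a partition from its columns\<close>

text \<open>Row lengths decrease, so the rows met by column \<open>k\<close> form an initial
  segment.\<close>

lemma less_column_len_iff:
  assumes "sorted_wrt (\<ge>) lam" "1 \<le> k"
  shows "i < column_len lam k \<longleftrightarrow> k \<le> row_len lam i"
  using assms(1)
proof (induction lam arbitrary: i)
  case Nil
  then show ?case using assms(2) by (simp add: column_len_def row_len_def)
next
  case (Cons x xs)
  have IH: "i < length (filter (\<lambda>x. k \<le> x) xs) \<longleftrightarrow> k \<le> row_len xs i" for i
    using Cons by (simp add: column_len_def)
  show ?case
  proof (cases "k \<le> x")
    case True
    then show ?thesis using IH[of "i - 1"]
      by (cases i) (auto simp: column_len_def row_len_def)
  next
    case False
    then have "filter (\<lambda>x. k \<le> x) (x # xs) = []"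
      using Cons.prems by (force simp: filter_empty_conv)
    moreover have "row_len (x # xs) i \<le> x"
      using Cons.prems by (auto simp: row_len_def nth_Cons')
    then have "\<not> k \<le> row_len (x # xs) i" using False by simp
    ultimately show ?thesis by (simp add: column_len_def)
  qed
qed

lemma column_len_antimono: "k \<le> k' \<Longrightarrow> column_len lam k' \<le> column_len lam k"
  unfolding column_len_def by (induction lam) auto

lemma column_len_eq_count: "column_len lam k = column_len lam (Suc k) + count (mset lam) k"
  unfolding column_len_def by (induction lam) auto

lemma decreasing_eqI:
  fixes xs ys :: "nat list"
  assumes "sorted_wrt (\<ge>) xs" "sorted_wrt (\<ge>) ys" "mset xs = mset ys"
  shows "xs = ys"
proof -
  have "sorted (rev xs)" "sorted (rev ys)"
    using assms by (auto simp: sorted_wrt_rev)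
  then have "rev xs = rev ys"
    using assms(3) by (metis mset_rev properties_for_sort)
  then show ?thesis by simp
qed

text \<open>For positive \<open>k\<close>, the multiplicity of the part \<open>k\<close> is the
  difference of columns \<open>k\<close> and \<open>Suc k\<close>. Columns thus fix the multiset of
  parts, and sortedness fixes the list.\<close>

lemma partition_eqI:
  assumes "sorted_wrt (\<ge>) lam" "sorted_wrt (\<ge>) mu"
    and "0 \<notin> set lam" "0 \<notin> set mu"
    and "\<And>k. 1 \<le> k \<Longrightarrow> column_len lam k = column_len mu k"
  shows "lam = mu"
proof (rule decreasing_eqI[OF assms(1,2)], rule multiset_eqI)
  fix k
  show "count (mset lam) k = count (mset mu) k"
  proof (cases k)
    case 0
    then show ?thesis using assms(3,4) by (metis count_mset_0_iff)
  next
    case (Suc m)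
    then show ?thesis
      using assms(5)[of k] assms(5)[of "Suc k"] column_len_eq_count[of lam k]
        column_len_eq_count[of mu k] by simp
  qed
qed

section \<open>Cell moves as column shifts\<close>

lemma length_filter_list_update:
  "i < length xs \<Longrightarrow>
   length (filter P (xs[i := x])) + of_bool (P (xs ! i)) = length (filter P xs) + of_bool (P x)"
proof (induction xs arbitrary: i)
  case (Cons y ys)
  then show ?case by (cases i) fastforce+
qed simp

lemma column_len_move_cell:
  assumes "i < length lam" "j \<le> length lam" "i \<noteq> j" "1 \<le> k"
  shows "column_len (move_cell lam i j) k + of_bool (k = row_len lam i)
       = column_len lam k + of_bool (k = row_len lam j + 1)"
proof -
  let ?P = "\<lambda>x. k \<le> x"
  define xs where "xs = lam @ [0]"
  \<comment> \<open>As \<open>i\<close> and \<open>j\<close> differ, the second update still sees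
    the old length of row \<open>j\<close>, so the updates can be counted one at a time. The 0
    appended in \<open>xs\<close> is the new row.\<close>
  define ys where "ys = xs[i := row_len lam i - 1]"
  have nth: "xs ! i = row_len lam i" "ys ! j = row_len lam j"
    using assms by (auto simp: xs_def ys_def row_len_def nth_append)
  \<comment> \<open>Neither reordering nor dropping zeros affects a column with \<open>k\<close> at
    least 1.\<close>
  have "length (filter ?P (rev (sort zs))) = length (filter ?P zs)" for zs :: "nat list"
    by (metis mset_filter mset_rev mset_sort size_mset)
  moreover have "filter ?P (filter (\<lambda>k. 0 < k) zs) = filter ?P zs" for zs :: "nat list"
    using assms(4) by (auto intro: filter_cong)
  ultimately have "column_len (move_cell lam i j) k
      = length (filter ?P (ys[j := row_len lam j + 1]))"
    by (simp add: column_len_def move_cell_def xs_def ys_def)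
  moreover have "length (filter ?P ys) + of_bool (?P (row_len lam i))
      = length (filter ?P xs) + of_bool (?P (row_len lam i - 1))"
    using length_filter_list_update[of i xs ?P] assms nth(1) by (simp add: ys_def xs_def)
  moreover have "length (filter ?P (ys[j := row_len lam j + 1])) + of_bool (?P (row_len lam j))
      = length (filter ?P ys) + of_bool (?P (row_len lam j + 1))"
    using length_filter_list_update[of j ys ?P] assms nth(2) by (simp add: ys_def xs_def)
  moreover have "length (filter ?P xs) = column_len lam k"
    using assms(4) by (simp add: xs_def column_len_def)
  \<comment> \<open>Passing from length \<open>r - 1\<close> to \<open>r\<close> affects column
    \<open>r\<close> only; for \<open>r = 0\<close> both tests fail because \<open>k\<close> is
    positive.\<close>
  moreover have "of_bool (?P r) = of_bool (?P (r - 1)) + (of_bool (k = r) :: nat)" for r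
    using assms(4) by (auto simp: of_bool_def)
  from this[of "row_len lam i"] this[of "row_len lam j + 1"] have
    "of_bool (?P (row_len lam i))
      = of_bool (?P (row_len lam i - 1)) + (of_bool (k = row_len lam i) :: nat)"
    "of_bool (?P (row_len lam j + 1))
      = of_bool (?P (row_len lam j)) + (of_bool (k = row_len lam j + 1) :: nat)"
    by simp_all
  ultimately show ?thesis by linarith
qed

text \<open>Adjacency allows a move in either direction; reversal swaps \<open>p\<close> and
  \<open>q\<close>.\<close>

lemma column_shift_sym: "column_shift lam mu p q \<Longrightarrow> column_shift mu lam q p"
  unfolding column_shift_def by auto

lemma sorted_move_cell: "sorted_wrt (\<ge>) (move_cell lam i j)"
  unfolding move_cell_def by (simp add: sorted_wrt_rev)

lemma zero_notin_move_cell: "0 \<notin> set (move_cell lam i j)"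
  unfolding move_cell_def by simp

lemma obtained_by_move_column_shift:
  assumes "partition_of n lam" "lam \<noteq> mu" "obtained_by_move lam mu"
  obtains p q where "column_shift lam mu p q"
proof -
  obtain i j where ij: "i < length lam" "j \<le> length lam" "i \<noteq> j" "mu = move_cell lam i j"
    using assms(3) unfolding obtained_by_move_def by blast
  have lam: "sorted_wrt (\<ge>) lam" "0 \<notin> set lam"
    using assms(1) by (auto simp: partition_of_def)
  have shift: "column_len mu k + of_bool (k = row_len lam i)
      = column_len lam k + of_bool (k = row_len lam j + 1)" if "1 \<le> k" for k
    using column_len_move_cell ij that by blast
  \<comment> \<open>If the two columns coincide, the move merely interchanges two row lengths and
    returns \<open>lam\<close>.\<close>
  have "row_len lam i \<noteq> row_len lam j + 1"
  proof
    assume "row_len lam i = row_len lam j + 1"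
    then have "lam = mu"
      using shift sorted_move_cell zero_notin_move_cell lam ij(4)
      by (intro partition_eqI) auto
    then show False using assms(2) by simp
  qed
  moreover have "1 \<le> row_len lam i"
    using lam ij(1) by (metis One_nat_def Suc_leI neq0_conv nth_mem row_len_def)
  ultimately show thesis
    using shift by (intro that[of "row_len lam i" "row_len lam j + 1"])
      (simp add: column_shift_def)
qed

lemma adjacent_column_shift:
  assumes "adjacent n lam mu"
  obtains p q where "column_shift lam mu p q"
  using assms obtained_by_move_column_shift column_shift_sym
  unfolding adjacent_def by metis

lemma column_shift_common:
  assumes "column_shift lam mu p q" "column_shift lam nu p' q'" "column_shift mu nu r s"
  shows "p = p' \<or> q = q'"
proof (rule ccontr)
  assume "\<not> (p = p' \<or> q = q')"
  moreover have "of_bool (k = q') + of_bool (k = p) + of_bool (k = r)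
      = of_bool (k = p') + of_bool (k = q) + (of_bool (k = s) :: nat)" if "1 \<le> k" for k
  proof -
    have "column_len mu k + of_bool (k = p) = column_len lam k + of_bool (k = q)"
      "column_len nu k + of_bool (k = p') = column_len lam k + of_bool (k = q')"
      "column_len nu k + of_bool (k = r) = column_len mu k + of_bool (k = s)"
      using assms that by (auto simp only: column_shift_def)
    then show ?thesis by linarith
  qed
  \<comment> \<open>With \<open>p\<close> distinct from \<open>p'\<close> and \<open>q\<close> from
    \<open>q'\<close>, the equation at \<open>p\<close> forces \<open>s = p\<close> and excludes
    \<open>p = q'\<close>, whereas the one at \<open>q'\<close> forces
    \<open>s = q'\<close>.\<close>
  from this[of p] this[of q'] have
    "of_bool (p = q') + 1 + of_bool (p = r) = of_bool (p = p') + of_bool (p = q) + (of_bool (p = s) :: nat)"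
    "1 + of_bool (q' = p) + of_bool (q' = r) = of_bool (q' = p') + of_bool (q' = q) + (of_bool (q' = s) :: nat)"
    using assms by (auto simp: column_shift_def)
  ultimately show False
    using assms unfolding column_shift_def by (auto simp: of_bool_def split: if_splits)
qed

section \<open>From column shifts back to corners and transfers\<close>

lemma ferrers_eq_row_len: "ferrers lam = {(i, j). j < row_len lam i}"
  unfolding ferrers_def row_len_def by (auto split: if_splits)

lemma addable_cornerI:
  assumes "partition_of n lam" "j \<le> length lam"
    and "\<And>i. i < j \<Longrightarrow> row_len lam j < lam ! i"
  shows "(j, row_len lam j) \<in> addable_corners lam"
proof -
  \<comment> \<open>Row \<open>j\<close> grows by one cell; for \<open>j = length lam\<close> this
    appends a row of length 1.\<close>
  define nu where "nu = take j lam @ (row_len lam j + 1) # drop (Suc j) lam"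
  have srt: "sorted_wrt (\<ge>) lam" and pos: "\<forall>k\<in>set lam. 0 < k"
    using assms(1) by (auto simp: partition_of_def)
  have above: "x \<ge> row_len lam j + 1" if "x \<in> set (take j lam)" for x
  proof -
    obtain m where "m < j" "x = lam ! m"
      using \<open>x \<in> set (take j lam)\<close> by (auto simp: in_set_conv_nth)
    then show ?thesis using assms(3)[of m] by simp
  qed
  have below: "y \<le> row_len lam j" if "y \<in> set (drop (Suc j) lam)" for y
  proof -
    obtain m where "m < length (drop (Suc j) lam)" "y = drop (Suc j) lam ! m"
      using \<open>y \<in> set (drop (Suc j) lam)\<close> unfolding in_set_conv_nth by blast
    then have "j < Suc j + m" "Suc j + m < length lam" "y = lam ! (Suc j + m)" by simp_all
    then show ?thesis using sorted_wrt_nth_less[OF srt] by (simp add: row_len_def)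
  qed
  have "y \<le> x" if "x \<in> set (take j lam)" "y \<in> set (drop (Suc j) lam)" for x y
    using above[OF that(1)] below[OF that(2)] by linarith
  moreover have "sorted_wrt (\<ge>) (take j lam)" "sorted_wrt (\<ge>) (drop (Suc j) lam)"
    using srt by (auto intro: sorted_wrt_take sorted_wrt_drop)
  ultimately have "sorted_wrt (\<ge>) nu"
    using above below by (auto simp: nu_def sorted_wrt_append intro: le_SucI)
  moreover have "\<forall>k\<in>set nu. 0 < k"
    using pos unfolding nu_def by (auto dest: in_set_takeD in_set_dropD)
  ultimately have "partition_of (sum_list nu) nu"
    by (simp add: partition_of_def)
  moreover have "row_len nu i = (if i = j then row_len lam j + 1 else row_len lam i)" for i
  proof -
    consider "i < j" | "i = j" | "j < i" by linarith
    then show ?thesis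
    proof cases
      case 3
      then obtain m where "i = Suc (j + m)" using less_imp_Suc_add by blast
      then show ?thesis
        using assms(2) by (auto simp: nu_def row_len_def nth_append)
    qed (use assms(2) in \<open>simp_all add: nu_def row_len_def nth_append\<close>)
  qed
  then have "ferrers nu = insert (j, row_len lam j) (ferrers lam)"
    by (auto simp: ferrers_eq_row_len split: if_splits)
  moreover have "(j, row_len lam j) \<notin> ferrers lam"
    by (simp add: ferrers_eq_row_len)
  ultimately show ?thesis
    unfolding addable_corners_def by blast
qed

text \<open>The bottom cell of column \<open>p\<close>; \<open>addable_at\<close> is the free place
  below column \<open>q\<close>. Each depends on one index only, so a common \<open>p\<close> or
  \<open>q\<close> yields a common corner. Columns counted from 1 cause the subtractions.\<close>

definition removable_at :: "nat list \<Rightarrow> nat \<Rightarrow> nat \<times> nat" where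
  "removable_at lam p = (column_len lam p - 1, p - 1)"

definition addable_at :: "nat list \<Rightarrow> nat \<Rightarrow> nat \<times> nat" where
  "addable_at lam q = (column_len lam q, q - 1)"

text \<open>The columns of \<open>mu\<close> also decrease. Hence in \<open>lam\<close> column
  \<open>p\<close> is strictly longer than the next one, and column \<open>q\<close> strictly
  shorter than the previous one if \<open>q > 1\<close>, which makes both cells corners.\<close>

lemma column_shift_transfer:
  assumes "partition_of n lam" "partition_of n mu" "column_shift lam mu p q"
  shows "admissible n lam (removable_at lam p) (addable_at lam q)"
    and "transfer_cell lam (removable_at lam p) (addable_at lam q) = mu"
proof -
  define i where "i = column_len lam p - 1"
  define j where "j = column_len lam q"
  have lam: "sorted_wrt (\<ge>) lam" "0 \<notin> set lam" and mu: "sorted_wrt (\<ge>) mu" "0 \<notin> set mu"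
    using assms by (auto simp: partition_of_def)
  have pq: "1 \<le> p" "1 \<le> q" "p \<noteq> q" and
    shift: "\<And>k. 1 \<le> k \<Longrightarrow> column_len mu k + of_bool (k = p) = column_len lam k + of_bool (k = q)"
    using assms(3) by (auto simp: column_shift_def)
  note row = less_column_len_iff[OF lam(1)]
  have col_p: "column_len lam (Suc p) < column_len lam p"
    using shift[of p] shift[of "Suc p"] pq column_len_antimono[of p "Suc p" mu]
    by (auto simp: of_bool_def split: if_splits)
  have col_q: "j < column_len lam (q - 1)" if "1 < q"
  proof -
    have "column_len mu q = j + 1"
      using shift[of q] pq by (simp add: j_def)
    moreover have "column_len mu (q - 1) \<le> column_len lam (q - 1)"
    proof -
      have "1 \<le> q - 1" "q - 1 \<noteq> q" using that by linarith+
      then show ?thesis using shift[of "q - 1"] by simp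
    qed
    ultimately show ?thesis
      using column_len_antimono[of "q - 1" q mu] by simp
  qed
  \<comment> \<open>Row \<open>i\<close> meets column \<open>p\<close> but not column
    \<open>Suc p\<close>.\<close>
  have i_row: "row_len lam i = p"
  proof -
    have "i < column_len lam p" "\<not> i < column_len lam (Suc p)"
      using col_p by (simp_all add: i_def)
    then show ?thesis using row[of p i] row[of "Suc p" i] pq(1) by simp
  qed
  have i_next: "row_len lam (Suc i) < p"
    using row[of p "Suc i"] col_p pq(1) by (simp add: i_def)
  have i_len: "i < length lam"
    using i_row pq(1) by (metis not_one_le_zero row_len_def)
  have j_row: "row_len lam j = q - 1"
  proof (cases "1 < q")
    case True
    then show ?thesis
      using row[of q j] row[of "q - 1" j] col_q by (simp add: j_def)
  next
    case False
    then show ?thesis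
      using row[of q j] pq(2) by (simp add: j_def)
  qed
  have j_len: "j \<le> length lam"
    unfolding j_def column_len_def by simp
  have j_prev: "row_len lam j < lam ! m" if "m < j" for m
    using row[of q m] that pq(2) j_row j_len by (simp add: j_def row_len_def)
  \<comment> \<open>In a common row \<open>q\<close> would be \<open>Suc p\<close>, and column
    \<open>q\<close> of \<open>mu\<close> would be longer than column \<open>p\<close>.\<close>
  have "i \<noteq> j"
  proof
    assume eq: "i = j"
    then have "q = Suc p" using i_row j_row pq by simp
    then show False
      using eq shift[of p] shift[of q] pq col_p column_len_antimono[of p q mu]
      by (auto simp: i_def j_def of_bool_def split: if_splits)
  qed
  have "move_cell lam i j = mu"
  proof (rule partition_eqI[OF sorted_move_cell mu(1) zero_notin_move_cell mu(2)])
    fix k :: nat assume "1 \<le> k"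
    then show "column_len (move_cell lam i j) k = column_len mu k"
      using column_len_move_cell[OF i_len j_len \<open>i \<noteq> j\<close>, of k] shift[of k] pq i_row j_row
      by simp
  qed
  moreover have rem: "removable_at lam p = (i, row_len lam i - 1)"
    and add: "addable_at lam q = (j, row_len lam j)"
    using i_row j_row by (auto simp: removable_at_def addable_at_def i_def j_def)
  ultimately show transfer: "transfer_cell lam (removable_at lam p) (addable_at lam q) = mu"
    by (simp add: transfer_cell_def)
  have "mu \<noteq> lam"
    using shift[of p] pq by auto
  moreover have "removable_at lam p \<in> removable_corners lam"
    using i_len i_next i_row unfolding rem removable_corners_def by auto
  moreover have "addable_at lam q \<in> addable_corners lam"
    unfolding add using addable_cornerI assms(1) j_len j_prev by blast
  ultimately show "admissible n lam (removable_at lam p) (addable_at lam q)"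
    using transfer assms(2) \<open>i \<noteq> j\<close> rem add by (simp add: admissible_def)
qed

section \<open>Assembling the simplex around a member of the clique\<close>

text \<open>If \<open>f\<close> differs at \<open>x\<close> and \<open>y\<close>, then
  \<open>g\<close> agrees there; any third point differs in \<open>f\<close> from one of them and so
  shares that value of \<open>g\<close>.\<close>

lemma pairwise_common_coordinate:
  assumes "\<And>x y. x \<in> M \<Longrightarrow> y \<in> M \<Longrightarrow> f x = f y \<or> g x = g y"
  shows "(\<exists>a. \<forall>x\<in>M. f x = a) \<or> (\<exists>b. \<forall>x\<in>M. g x = b)"
  using assms by metis

text \<open>Serves one-vertex cliques: a star-simplex needs a base corner even when \<open>A\<close>
  is empty. The end of the last row is one.\<close>

lemma removable_corner_exists:
  assumes "partition_of n lam" "n \<ge> 1"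
  obtains c where "c \<in> removable_corners lam"
proof -
  have "lam \<noteq> []" and pos: "\<forall>k\<in>set lam. 0 < k"
    using assms by (auto simp: partition_of_def)
  then have "0 < row_len lam (length lam - 1)" "row_len lam (length lam) = 0"
    by (auto simp: row_len_def)
  then have "(length lam - 1, row_len lam (length lam - 1) - 1) \<in> removable_corners lam"
    using \<open>lam \<noteq> []\<close> unfolding removable_corners_def by auto
  then show thesis by (rule that)
qed

theorem theorem3p6:
  fixes n :: nat and K :: "nat list set"
  assumes "n \<ge> 1" and "is_clique n K"
  shows "(\<exists>S. star_simplex n S \<and> K \<subseteq> S) \<or> (\<exists>S. top_simplex n S \<and> K \<subseteq> S)"
proof -
  have fin: "finite K" and part: "\<And>mu. mu \<in> K \<Longrightarrow> partition_of n mu"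
    and adj: "pairwise (adjacent n) K"
    using assms(2) by (auto simp: is_clique_def)
  obtain lam where lam: "lam \<in> K"
    using assms(2) by (auto simp: is_clique_def)
  define M where "M = K - {lam}"
  have K: "K = insert lam M" and fin_M: "finite M"
    using lam fin by (auto simp: M_def)
  have "\<forall>mu\<in>M. \<exists>p q. column_shift lam mu p q"
    using adj lam adjacent_column_shift by (metis DiffE M_def insertI1 pairwiseD)
  then obtain P Q where PQ: "\<And>mu. mu \<in> M \<Longrightarrow> column_shift lam mu (P mu) (Q mu)"
    by metis
  have "P mu = P nu \<or> Q mu = Q nu" if "mu \<in> M" "nu \<in> M" for mu nu
  proof (cases "mu = nu")
    case False
    then have "adjacent n mu nu"
      using that adj by (auto simp: M_def pairwise_def)
    then show ?thesis
      using PQ that adjacent_column_shift column_shift_common by metis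
  qed simp
  then have line: "(\<exists>p. \<forall>mu\<in>M. P mu = p) \<or> (\<exists>q. \<forall>mu\<in>M. Q mu = q)"
    by (rule pairwise_common_coordinate)
  have adm: "admissible n lam (removable_at lam (P mu)) (addable_at lam (Q mu))"
    and trans: "transfer_cell lam (removable_at lam (P mu)) (addable_at lam (Q mu)) = mu"
    if "mu \<in> M" for mu
    using column_shift_transfer[OF part[OF lam] part PQ[OF that]] that by (auto simp: M_def)
  show ?thesis
  \<comment> \<open>Below, a member \<open>nu\<close> of \<open>M\<close> certifies that the common
    cell is a corner, so empty \<open>M\<close> is treated apart.\<close>
  proof (cases "M = {}")
    case True
    obtain c where "c \<in> removable_corners lam"
      using removable_corner_exists part[OF lam] assms(1) by blast
    then have "star_simplex_at n lam c {lam}"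
      unfolding star_simplex_at_def using part[OF lam] by (intro conjI exI[of _ "{}"]) auto
    then show ?thesis
      using True K unfolding star_simplex_def by blast
  next
    case False
    then obtain nu where nu: "nu \<in> M" by blast
    from line show ?thesis
    proof
      assume "\<exists>p. \<forall>mu\<in>M. P mu = p"
      then obtain p where p: "\<And>mu. mu \<in> M \<Longrightarrow> P mu = p" by blast
      have "star_simplex_at n lam (removable_at lam p) K"
        unfolding star_simplex_at_def
      proof (intro conjI exI[of _ "(\<lambda>mu. addable_at lam (Q mu)) ` M"])
        show "removable_at lam p \<in> removable_corners lam"
          using adm[OF nu] p[OF nu] by (simp add: admissible_def)
        show "K = insert lam ((\<lambda>a. transfer_cell lam (removable_at lam p) a)
            ` (\<lambda>mu. addable_at lam (Q mu)) ` M)"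
          using trans p by (simp add: K image_image)
      qed (use adm p part lam fin_M in \<open>auto simp: admissible_def\<close>)
      then show ?thesis unfolding star_simplex_def by blast
    next
      assume "\<exists>q. \<forall>mu\<in>M. Q mu = q"
      then obtain q where q: "\<And>mu. mu \<in> M \<Longrightarrow> Q mu = q" by blast
      have "top_simplex_at n lam (addable_at lam q) K"
        unfolding top_simplex_at_def
      proof (intro conjI exI[of _ "(\<lambda>mu. removable_at lam (P mu)) ` M"])
        show "addable_at lam q \<in> addable_corners lam"
          using adm[OF nu] q[OF nu] by (simp add: admissible_def)
        show "K = insert lam ((\<lambda>c. transfer_cell lam c (addable_at lam q))
            ` (\<lambda>mu. removable_at lam (P mu)) ` M)"
          using trans q by (simp add: K image_image)
      qed (use adm q part lam fin_M in \<open>auto simp: admissible_def\<close>)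
      then show ?thesis unfolding top_simplex_def by blast
    qed
  qed
qed

end
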